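(* Let $p$ and $q$ be two distributions on a discrete set $\mathcal X$ that satisfy the bounded likelihood-ratio assumption: there is a constant $C>1$ such that $\frac1C\le\frac{p(x)}{q(x)}\le C$ for all $x\in\mathcal X$. Let $\alpha,\beta\in(0,1/4)$. Then $$n^*_{\mathrm{SEQ}}(p,q,\alpha,\beta)\asymp\frac{\log(1/\min\{\alpha,\beta\})}{h^2(p,q)},$$ where the implied constants may depend on $C$ but not otherwise on $p,q,\alpha,\beta$.
   Context: A sequential hypothesis test observes i.i.d. samples $X_1,X_2,\dots$ one at a time; it consists of a stopping time $T$ (the event $\{T=t\}$ depends only on the samples observed up to time $t$) and a decision $\phi(X_1,\dots,X_T)\in\{p,q\}$. $n^*_{\mathrm{SEQ}}(p,q,\alpha,\beta)$ is the smallest (infimum) $n$ for which there is a sequential test with $\mathbb P_p(\phi(X_1,\dots,X_T)\ne p)\le\alpha$, $\mathbb P_q(\phi(X_1,\dots,X_T)\ne q)\le\beta$ and $\max\{\mathbb E_pT,\mathbb E_qT\}\le n$, where the subscript indicates the common distribution of the samples ($+\infty$ if there is none; $x/0=+\infty$ for $x>0$). $h^2(p,q)=\frac12\sum_i(\sqrt{p_i}-\sqrt{q_i})^2$. $A\asymp B$ means $c_1B\le A\le c_2B$ for constants $c_1,c_2>0$. *)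

theory Defs
  imports "HOL-Probability.Probability"
begin

text \<open>The two possible answers of a test are kept as formal labels, so that they remain distinct
  when the distributions coincide; for \<open>p = q\<close> no sequential test with small errors exists.\<close>

datatype hypothesis = Hyp_p | Hyp_q

text \<open>\<open>\<omega> i\<close> is the sample \<open>X\<close> number \<open>i + 1\<close>. As the alphabet is countable, every set that depends on
  finitely many samples is measurable for \<open>iid_samples p\<close>.\<close>

definition iid_samples :: "'a::countable pmf \<Rightarrow> (nat \<Rightarrow> 'a) measure" where
  "iid_samples p = (\<Pi>\<^sub>M i\<in>UNIV. measure_pmf p)"

definition sequential_stopping_time :: "((nat \<Rightarrow> 'a) \<Rightarrow> enat) \<Rightarrow> bool" where
  "sequential_stopping_time T \<longleftrightarrow>
     (\<forall>t::nat. \<forall>\<omega> \<omega>'. (\<forall>i<t. \<omega> i = \<omega>' i) \<longrightarrow> (T \<omega> = enat t \<longleftrightarrow> T \<omega>' = enat t))"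

text \<open>No answer is given when the test never stops; below this counts as an error under either
  hypothesis. It has probability zero as soon as the expected stopping time is finite.\<close>

definition test_output ::
    "((nat \<Rightarrow> 'a) \<Rightarrow> enat) \<Rightarrow> ('a list \<Rightarrow> hypothesis) \<Rightarrow> (nat \<Rightarrow> 'a) \<Rightarrow> hypothesis option" where
  "test_output T \<phi> \<omega> =
     (case T \<omega> of enat t \<Rightarrow> Some (\<phi> (map \<omega> [0..<t])) | \<infinity> \<Rightarrow> None)"

definition error_prob ::
    "'a::countable pmf \<Rightarrow> hypothesis \<Rightarrow> ((nat \<Rightarrow> 'a) \<Rightarrow> enat) \<Rightarrow> ('a list \<Rightarrow> hypothesis) \<Rightarrow> real" where
  "error_prob r H T \<phi> = measure (iid_samples r) {\<omega>. test_output T \<phi> \<omega> \<noteq> Some H}"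

definition expected_time :: "'a::countable pmf \<Rightarrow> ((nat \<Rightarrow> 'a) \<Rightarrow> enat) \<Rightarrow> ennreal" where
  "expected_time r T = (\<integral>\<^sup>+ \<omega>. ennreal_of_enat (T \<omega>) \<partial>iid_samples r)"

definition n_SEQ :: "'a::countable pmf \<Rightarrow> 'a pmf \<Rightarrow> real \<Rightarrow> real \<Rightarrow> ennreal" where
  "n_SEQ p q \<alpha> \<beta> = (INF n \<in> {n::real. 0 \<le> n \<and>
     (\<exists>T \<phi>. sequential_stopping_time T \<and>
        error_prob p Hyp_p T \<phi> \<le> \<alpha> \<and> error_prob q Hyp_q T \<phi> \<le> \<beta> \<and>
        max (expected_time p T) (expected_time q T) \<le> ennreal n)}. ennreal n)"

definition hellinger_sq :: "'a pmf \<Rightarrow> 'a pmf \<Rightarrow> real" where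
  "hellinger_sq p q = 1/2 * (\<Sum>\<^sub>\<infinity>x. (sqrt (pmf p x) - sqrt (pmf q x))\<^sup>2)"

text \<open>\<open>X\<close> is a subset of the type rather than the whole type, so that the type \<open>nat\<close> already covers
  all discrete sets, finite or infinite: constants that are uniform in \<open>X\<close> are then uniform in the
  alphabet size. Since real division by zero is zero, the lower bound forces both distributions
  to have full support on \<open>X\<close>.\<close>

definition bounded_likelihood_ratio :: "real \<Rightarrow> 'a set \<Rightarrow> 'a pmf \<Rightarrow> 'a pmf \<Rightarrow> bool" where
  "bounded_likelihood_ratio C X p q \<longleftrightarrow> (\<forall>x\<in>X. 1 / C \<le> pmf p x / pmf q x \<and> pmf p x / pmf q x \<le> C)"

end

theory Submission
  imports Defs
begin

text \<open>Upper bound: the likelihood ratio test with a fixed number \<open>n\<close> of samples has both errors at most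
  the \<open>n\<close>-th power of the Bhattacharyya coefficient \<open>1 - h\<^sup>2\<close>, so that \<open>n = \<lceil>ln (1 / min \<alpha> \<beta>) / h\<^sup>2\<rceil>\<close> is
  enough.

  Lower bound: assume \<open>\<beta> \<le> \<alpha>\<close> by symmetry and let the mean stopping time under \<open>p\<close>
  be at most \<open>n\<close>. By Markov's inequality the test stops
  by time \<open>N = \<lfloor>25 n\<rfloor>\<close> except with probability \<open>1/25\<close>, which replaces Wald's identity: the event
  \<open>A\<close> that the test has answered \<open>p\<close> by time \<open>N\<close> is determined by \<open>N\<close> samples, has probability at least \<open>71/100\<close>
  under \<open>p\<close> and at most \<open>\<beta>\<close> under \<open>q\<close>. By the Cauchy--Schwarz inequality
  \<open>P(A)\<^sup>2 \<le> Q(A) (1 + \<chi>\<^sup>2)\<^sup>N\<close>, and the bounded likelihood ratio gives \<open>\<chi>\<^sup>2 \<le> 2 (\<surd>C + 1)\<^sup>2 h\<^sup>2\<close>. As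
  \<open>(71/100)\<^sup>2 \<ge> 1/2\<close> and \<open>2 ln 2 \<le> ln (1/\<beta>)\<close>, this bounds \<open>n\<close> from below.\<close>

section \<open>Product distributions and finite prefixes of the sample sequence\<close>

lemma pmf_replicate_pmf:
  "pmf (replicate_pmf n p) xs = (if length xs = n then prod_list (map (pmf p) xs) else 0)"
proof (induction n arbitrary: xs)
  case 0
  then show ?case by (auto simp: indicator_def)
next
  case (Suc n)
  show ?case
  proof (cases xs)
    case Nil
    then show ?thesis
      by (simp add: pmf_eq_0_set_pmf set_replicate_pmf del: replicate_pmf.simps)
  next
    case (Cons y ys)
    have "replicate_pmf (Suc n) p = map_pmf (\<lambda>(x, xs). x # xs) (pair_pmf p (replicate_pmf n p))"
      by (simp add: pair_pmf_def map_bind_pmf map_pmf_def bind_assoc_pmf bind_return_pmf)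
    moreover have "pmf (map_pmf (\<lambda>(x, xs). x # xs) (pair_pmf p (replicate_pmf n p))) 
        ((\<lambda>(x, xs). x # xs) (y, ys)) = pmf (pair_pmf p (replicate_pmf n p)) (y, ys)"
      by (rule pmf_map_inj') (auto simp: inj_on_def)
    ultimately show ?thesis
      using Suc.IH[of ys] Cons by (simp add: pmf_pair)
  qed
qed

text \<open>Independence. Serves both bounds: \<open>f\<close> is the square root of a likelihood
  ratio in the upper one and its square in the lower one.\<close>

lemma nn_integral_prod_list_replicate_pmf:
  fixes f :: "'a \<Rightarrow> real"
  assumes "\<And>x. 0 \<le> f x"
  shows "(\<integral>\<^sup>+xs. ennreal (prod_list (map f xs)) \<partial>replicate_pmf n p) = (\<integral>\<^sup>+x. ennreal (f x) \<partial>p) ^ n"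
proof (induction n)
  case (Suc n)
  have "0 \<le> prod_list (map f xs)" for xs
    by (induction xs) (auto simp: assms)
  then show ?case
    using Suc.IH by (simp add: ennreal_mult assms nn_integral_cmult nn_integral_multc)
qed simp

lemma space_iid_samples [simp]: "space (iid_samples p) = UNIV"
  by (auto simp: iid_samples_def space_PiM PiE_def)

lemma prob_space_iid_samples: "prob_space (iid_samples p)"
  unfolding iid_samples_def by (intro prob_space_PiM measure_pmf.prob_space_axioms)

text \<open>Passes from the infinite product to a discrete distribution on lists. Lists are
  countable, so singletons suffice, and the preimage of a singleton is a cylinder or empty.\<close>

lemma
  fixes p :: "'a::countable pmf"
  shows measurable_prefix: "(\<lambda>\<omega>. map \<omega> [0..<n]) \<in> iid_samples p \<rightarrow>\<^sub>M count_space UNIV" (is ?A)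
    and distr_prefix:
      "distr (iid_samples p) (count_space UNIV) (\<lambda>\<omega>. map \<omega> [0..<n]) = replicate_pmf n p" (is ?B)
proof -
  interpret product_prob_space "\<lambda>_::nat. measure_pmf p" UNIV
    by unfold_locales
  have eq: "(\<lambda>\<omega>. map \<omega> [0..<n]) -` {xs} =
      (if length xs = n then {\<omega>\<in>space (iid_samples p). \<forall>i\<in>{..<n}. \<omega> i \<in> {xs ! i}} else {})" for xs :: "'a list"
  proof (cases "length xs = n")
    case True
    then show ?thesis
      by (simp add: list_eq_iff_nth_eq vimage_def Ball_def)
  qed auto
  have cyl: "{\<omega>\<in>space (iid_samples p). \<forall>i\<in>{..<n}. \<omega> i \<in> {xs ! i}} \<in> sets (iid_samples p)" for xs
    unfolding iid_samples_def by measurable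
  show meas: ?A
    unfolding measurable_count_space_eq_countable[OF countableI_type]
  proof (intro conjI ballI)
    fix xs :: "'a list"
    show "(\<lambda>\<omega>. map \<omega> [0..<n]) -` {xs} \<inter> space (iid_samples p) \<in> sets (iid_samples p)"
      unfolding eq using cyl[of xs] by (cases "length xs = n") simp_all
  qed auto
  show ?B
  proof (rule measure_eqI_countable[of _ UNIV])
    fix xs :: "'a list"
    have "emeasure (iid_samples p) {\<omega>\<in>space (iid_samples p). \<forall>i\<in>{..<n}. \<omega> i \<in> {xs ! i}} =
        ennreal (\<Prod>i<n. pmf p (xs ! i))"
      unfolding iid_samples_def
      by (subst emeasure_PiM_Collect) (auto simp: emeasure_pmf_single prod_ennreal)
    moreover have "(\<Prod>i<length xs. pmf p (xs ! i)) = prod_list (map (pmf p) xs)"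
      by (induction xs) (simp_all add: prod.lessThan_Suc_shift del: prod.lessThan_Suc)
    ultimately show "emeasure (distr (iid_samples p) (count_space UNIV) (\<lambda>\<omega>. map \<omega> [0..<n])) {xs} =
        emeasure (replicate_pmf n p) {xs}"
      by (auto simp: emeasure_distr meas eq emeasure_pmf_single pmf_replicate_pmf)
  qed auto
qed

lemma
  fixes p :: "'a::countable pmf"
  assumes "\<And>\<omega> \<omega>'. (\<And>i. i < n \<Longrightarrow> \<omega> i = \<omega>' i) \<Longrightarrow> P \<omega> = P \<omega>'"
  shows prefix_event_measurable: "{\<omega>. P \<omega>} \<in> sets (iid_samples p)"
    and measure_prefix_event: "measure (iid_samples p) {\<omega>. P \<omega>} =
      measure_pmf.prob (replicate_pmf n p) {xs. P (\<lambda>i. xs ! i)}"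
proof -
  \<comment> \<open>Beyond index \<open>n\<close> the list access has an unspecified value, which
    \<open>P\<close> ignores by assumption.\<close>
  have P_eq: "P \<omega> = P (\<lambda>i. map \<omega> [0..<n] ! i)" for \<omega>
    by (rule assms) simp
  have eq: "{\<omega>. P \<omega>} = (\<lambda>\<omega>. map \<omega> [0..<n]) -` {xs. P (\<lambda>i. xs ! i)} \<inter> space (iid_samples p)"
    by (simp add: vimage_def flip: P_eq)
  show "{\<omega>. P \<omega>} \<in> sets (iid_samples p)"
    unfolding eq by (rule measurable_sets[OF measurable_prefix]) simp
  show "measure (iid_samples p) {\<omega>. P \<omega>} =
      measure_pmf.prob (replicate_pmf n p) {xs. P (\<lambda>i. xs ! i)}"
    unfolding eq by (subst distr_prefix[symmetric], subst measure_distr) (auto intro: measurable_prefix)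
qed

section \<open>Hellinger distance and affinity\<close>

lemma hellinger_sq_sym: "hellinger_sq p q = hellinger_sq q p"
  by (simp add: hellinger_sq_def power2_commute)

lemma integrable_sqrt_pmf_diff:
  "integrable (count_space UNIV) (\<lambda>x. (sqrt (pmf p x) - sqrt (pmf q x))\<^sup>2)"
proof (rule Bochner_Integration.integrable_bound)
  show "integrable (count_space UNIV) (\<lambda>x. pmf p x + pmf q x)"
    by (intro Bochner_Integration.integrable_add integrable_pmf)
  show "AE x in count_space UNIV. norm ((sqrt (pmf p x) - sqrt (pmf q x))\<^sup>2) \<le> norm (pmf p x + pmf q x)"
  proof (rule AE_I2)
    fix x
    have "(sqrt (pmf p x) - sqrt (pmf q x))\<^sup>2 \<le> pmf p x + pmf q x"
      by (simp add: power2_diff)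
    then show "norm ((sqrt (pmf p x) - sqrt (pmf q x))\<^sup>2) \<le> norm (pmf p x + pmf q x)"
      by simp
  qed
qed simp

text \<open>Absolute summability identifies the unordered sum with a Bochner integral for counting
  measure.\<close>

lemma hellinger_sq_eq_integral:
  "hellinger_sq p q = 1/2 * (\<integral>x. (sqrt (pmf p x) - sqrt (pmf q x))\<^sup>2 \<partial>count_space UNIV)"
  using infsetsum_infsum[of "\<lambda>x. (sqrt (pmf p x) - sqrt (pmf q x))\<^sup>2" UNIV] integrable_sqrt_pmf_diff[of p q]
  unfolding hellinger_sq_def Infinite_Set_Sum.abs_summable_on_def infsetsum_def by simp

lemma hellinger_sq_nonneg: "0 \<le> hellinger_sq p q"
  unfolding hellinger_sq_eq_integral by (simp add: Bochner_Integration.integral_nonneg)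

lemma integral_pmf_UNIV: "(\<integral>x. pmf p x \<partial>count_space UNIV) = 1"
  by (simp add: integral_pmf)

text \<open>The Bhattacharyya coefficient: expand the square in the Hellinger distance and use that
  both total masses are 1.\<close>

lemma has_bochner_integral_affinity:
  "has_bochner_integral (count_space UNIV) (\<lambda>x. sqrt (pmf p x * pmf q x)) (1 - hellinger_sq p q)"
proof -
  have "sqrt (pmf p x * pmf q x) =
      1/2 * (pmf p x + pmf q x) - 1/2 * (sqrt (pmf p x) - sqrt (pmf q x))\<^sup>2" for x
    by (simp add: power2_diff real_sqrt_mult field_simps)
  moreover have "has_bochner_integral (count_space UNIV)
      (\<lambda>x. 1/2 * (pmf p x + pmf q x) - 1/2 * (sqrt (pmf p x) - sqrt (pmf q x))\<^sup>2)
      (1/2 * (1 + 1) - hellinger_sq p q)"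
    unfolding hellinger_sq_eq_integral
    by (intro has_bochner_integral_diff has_bochner_integral_mult_right has_bochner_integral_add
        has_bochner_integral_integrable integrable_sqrt_pmf_diff)
      (metis has_bochner_integral_iff integrable_pmf integral_pmf_UNIV)+
  ultimately show ?thesis by simp
qed

lemma hellinger_sq_le_1: "hellinger_sq p q \<le> 1"
proof -
  have "0 \<le> (\<integral>x. sqrt (pmf p x * pmf q x) \<partial>count_space UNIV)"
    by (intro Bochner_Integration.integral_nonneg) simp
  then show ?thesis
    unfolding has_bochner_integral_integral_eq[OF has_bochner_integral_affinity] by simp
qed

section \<open>Upper bound: likelihood ratio test with a fixed sample size\<close>

lemma nn_integral_sqrt_ratio:
  fixes p q :: "'a pmf"
  shows "(\<integral>\<^sup>+x. ennreal (sqrt (pmf q x / pmf p x)) \<partial>p) = ennreal (1 - hellinger_sq p q)"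
proof -
  \<comment> \<open>Where \<open>pmf p x = 0\<close> both sides vanish, so absolute continuity is
    not an issue.\<close>
  have "pmf p x * sqrt (pmf q x / pmf p x) = sqrt (pmf p x * pmf q x)" for x
    by (cases "pmf p x = 0") (simp_all add: real_sqrt_mult real_sqrt_divide field_simps)
  then have "(\<integral>\<^sup>+x. ennreal (sqrt (pmf q x / pmf p x)) \<partial>p) =
      (\<integral>\<^sup>+x. ennreal (sqrt (pmf p x * pmf q x)) \<partial>count_space UNIV)"
    by (simp add: nn_integral_measure_pmf flip: ennreal_mult)
  also have "\<dots> = ennreal (1 - hellinger_sq p q)"
    using has_bochner_integral_affinity[of p q]
    by (subst nn_integral_eq_integral) (auto simp: has_bochner_integral_iff)
  finally show ?thesis .
qed

text \<open>Chernoff bound with exponent 1/2: on the event the square root of the likelihood ratio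
  is at least 1, so the probability is at most its mean, the \<open>n\<close>-th power of the
  affinity.\<close>

lemma likelihood_ratio_test_error:
  "measure_pmf.prob (replicate_pmf n p)
      {xs. prod_list (map (pmf p) xs) \<le> prod_list (map (pmf q) xs)} \<le> exp (- real n * hellinger_sq p q)"
proof -
  let ?A = "{xs. prod_list (map (pmf p) xs) \<le> prod_list (map (pmf q) xs)}"
  let ?g = "\<lambda>xs. prod_list (map (\<lambda>x. sqrt (pmf q x / pmf p x)) xs)"
  have g: "?g xs = sqrt (prod_list (map (pmf q) xs) / prod_list (map (pmf p) xs))" for xs
    by (induction xs) (simp_all add: real_sqrt_mult real_sqrt_divide)
  \<comment> \<open>The support is needed: if the \<open>p\<close>-likelihood of \<open>xs\<close>
    is zero, the quotient is zero by convention.\<close>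
  have "1 \<le> ?g xs" if "xs \<in> set_pmf (replicate_pmf n p)" "xs \<in> ?A" for xs
  proof -
    have "pmf (replicate_pmf n p) xs > 0"
      using that by (simp add: pmf_positive)
    then show ?thesis
      using that(2) by (auto simp: g pmf_replicate_pmf split: if_splits)
  qed
  then have "emeasure (replicate_pmf n p) ?A \<le> (\<integral>\<^sup>+xs. ennreal (?g xs) \<partial>replicate_pmf n p)"
    by (subst nn_integral_indicator[symmetric], simp, intro nn_integral_mono_AE AE_pmfI)
      (auto simp: indicator_def)
  also have "\<dots> = ennreal ((1 - hellinger_sq p q) ^ n)"
    by (subst nn_integral_prod_list_replicate_pmf)
      (simp_all add: nn_integral_sqrt_ratio ennreal_power hellinger_sq_le_1)
  finally have "measure_pmf.prob (replicate_pmf n p) ?A \<le> (1 - hellinger_sq p q) ^ n"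
    by (simp add: measure_pmf.emeasure_eq_measure hellinger_sq_le_1)
  also have "\<dots> \<le> exp (- hellinger_sq p q) ^ n"
    using exp_ge_add_one_self[of "- hellinger_sq p q"] by (intro power_mono) (simp_all add: hellinger_sq_le_1)
  also have "\<dots> = exp (- real n * hellinger_sq p q)"
    by (simp flip: exp_of_nat_mult)
  finally show ?thesis .
qed

lemma error_prob_const:
  fixes r :: "'a::countable pmf"
  shows "error_prob r H (\<lambda>_. enat n) \<phi> = measure_pmf.prob (replicate_pmf n r) {xs. \<phi> xs \<noteq> H}"
proof -
  have "error_prob r H (\<lambda>_. enat n) \<phi> =
      measure (iid_samples r) {\<omega>. \<phi> (map \<omega> [0..<n]) \<noteq> H}"
    by (simp add: error_prob_def test_output_def)
  also have "\<dots> = measure (distr (iid_samples r) (count_space UNIV) (\<lambda>\<omega>. map \<omega> [0..<n])) {xs. \<phi> xs \<noteq> H}"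
    by (subst measure_distr) (auto intro: measurable_prefix arg_cong2[where f=measure])
  finally show ?thesis by (simp add: distr_prefix)
qed

lemma n_SEQ_upper:
  fixes p q :: "'a::countable pmf"
  assumes "\<alpha> \<in> {0<..<1/4}" "\<beta> \<in> {0<..<1/4}"
  shows "n_SEQ p q \<alpha> \<beta> \<le> 2 * (ennreal (ln (1 / min \<alpha> \<beta>)) / ennreal (hellinger_sq p q))"
proof (cases "hellinger_sq p q = 0")
  case True
  \<comment> \<open>With distance zero, the positive logarithm makes the right-hand side
    infinite.\<close>
  have "1 < 1 / min \<alpha> \<beta>"
    using assms by (auto simp: min_def)
  then have "0 < ln (1 / min \<alpha> \<beta>)"
    by (rule ln_gt_zero)
  then have "ennreal (ln (1 / min \<alpha> \<beta>)) / ennreal (hellinger_sq p q) = \<top>"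
    unfolding True by (simp add: ennreal_divide_zero ennreal_eq_0_iff)
  then show ?thesis
    by (simp add: ennreal_mult_top)
next
  case False
  define h where "h = hellinger_sq p q"
  define L where "L = ln (1 / min \<alpha> \<beta>)"
  define n where "n = nat \<lceil>L / h\<rceil>"
  define \<phi> where
    "\<phi> xs = (if prod_list (map (pmf p) xs) \<le> prod_list (map (pmf q) xs) then Hyp_q else Hyp_p)" for xs
  have h: "0 < h" "h \<le> 1"
    using False hellinger_sq_nonneg[of p q] hellinger_sq_le_1[of p q] by (auto simp: h_def)
  have m: "0 < min \<alpha> \<beta>" "min \<alpha> \<beta> < 1/4"
    using assms by auto
  \<comment> \<open>Error levels below 1/4 give \<open>L > 1\<close>, hence
    \<open>L / h \<ge> 1\<close> as \<open>h \<le> 1\<close>; rounding up then at most doubles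
    \<open>L / h\<close>, whence the constant 2.\<close>
  have "exp 1 < (4::real)"
    using exp_le by linarith
  also have "4 < 1 / min \<alpha> \<beta>"
    using m by (simp add: field_simps)
  finally have "ln (exp 1) < L"
    unfolding L_def using m by (subst ln_less_cancel_iff) auto
  then have "1 < L"
    by simp
  then have "1 \<le> L / h"
    using h by (simp add: field_simps)
  have n: "L / h \<le> real n" "real n \<le> 2 * (L / h)"
    using \<open>1 \<le> L / h\<close> unfolding n_def by linarith+
  have "L \<le> real n * h"
    using n(1) h by (simp add: field_simps)
  then have "exp (- real n * h) \<le> exp (- L)"
    by simp
  also have "exp (- L) = min \<alpha> \<beta>"
    using m by (simp add: L_def exp_minus)
  finally have e: "exp (- real n * h) \<le> min \<alpha> \<beta>" .
  have "error_prob p Hyp_p (\<lambda>_. enat n) \<phi> \<le> \<alpha>"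
    using likelihood_ratio_test_error[of n p q] e
    unfolding error_prob_const by (simp add: \<phi>_def h_def)
  moreover have "error_prob q Hyp_q (\<lambda>_. enat n) \<phi> \<le> \<beta>"
  proof -
    \<comment> \<open>Ties are decided for \<open>q\<close>, so this error event is strict; adding
      the ties lets the same estimate apply with \<open>p\<close> and \<open>q\<close>
      exchanged.\<close>
    have "error_prob q Hyp_q (\<lambda>_. enat n) \<phi> \<le> measure_pmf.prob (replicate_pmf n q)
      {xs. prod_list (map (pmf q) xs) \<le> prod_list (map (pmf p) xs)}"
      unfolding error_prob_const by (intro measure_pmf.finite_measure_mono) (auto simp: \<phi>_def)
    then show ?thesis
      using likelihood_ratio_test_error[of n q p] e by (simp add: h_def hellinger_sq_sym[of q p])
  qed
  moreover have "expected_time r (\<lambda>_. enat n) = ennreal (real n)" for r :: "'a pmf"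
    using prob_space.emeasure_space_1[OF prob_space_iid_samples[of r]]
    by (simp add: expected_time_def ennreal_of_nat_eq_real_of_nat)
  moreover have "sequential_stopping_time (\<lambda>_::nat \<Rightarrow> 'a. enat n)"
    by (simp add: sequential_stopping_time_def)
  ultimately have "n_SEQ p q \<alpha> \<beta> \<le> ennreal (real n)"
    unfolding n_SEQ_def by (intro INF_lower CollectI conjI exI[of _ "\<lambda>_. enat n"] exI[of _ \<phi>]) auto
  also have "\<dots> \<le> ennreal (2 * (L / h))"
    using n(2) by (rule ennreal_leI)
  also have "\<dots> = 2 * (ennreal L / ennreal h)"
    using h \<open>1 < L\<close> ennreal_mult[of 2 "L / h"] by (simp add: divide_ennreal)
  finally show ?thesis by (simp add: L_def h_def)
qed


section \<open>Lower bound: change of measure and the second moment of the likelihood ratio\<close>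

lemma
  assumes "C > 1" "set_pmf p \<subseteq> X" "set_pmf q \<subseteq> X" "bounded_likelihood_ratio C X p q"
  shows bounded_likelihood_ratio_le: "pmf p x \<le> C * pmf q x"
    and bounded_likelihood_ratio_ge: "pmf q x \<le> C * pmf p x"
proof -
  have "pmf p x \<le> C * pmf q x \<and> pmf q x \<le> C * pmf p x"
  proof (cases "x \<in> X")
    case True
    then have r: "1 / C \<le> pmf p x / pmf q x" "pmf p x / pmf q x \<le> C"
      using assms(4) by (auto simp: bounded_likelihood_ratio_def)
    have "0 < pmf p x / pmf q x"
      using r(1) assms(1) by (smt (verit) zero_less_divide_1_iff)
    \<comment> \<open>A zero denominator would make the quotient zero, against the lower bound
      \<open>1 / C\<close>.\<close>
    then have "0 < pmf q x"
      using pmf_nonneg[of q x] by (cases "pmf q x = 0") auto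
    then show ?thesis
      using r assms(1) by (simp add: field_simps)
  next
    case False
    then have "pmf p x = 0" "pmf q x = 0"
      using assms(2,3) by (auto simp: pmf_eq_0_set_pmf)
    then show ?thesis
      by simp
  qed
  then show "pmf p x \<le> C * pmf q x" "pmf q x \<le> C * pmf p x"
    by simp_all
qed

lemma nn_integral_ratio_sq_le:
  fixes p q :: "'a pmf"
  assumes "C > 1" and le: "\<And>x. pmf p x \<le> C * pmf q x"
  shows "(\<integral>\<^sup>+x. ennreal ((pmf p x / pmf q x)\<^sup>2) \<partial>q) \<le> ennreal (1 + 2 * (sqrt C + 1)\<^sup>2 * hellinger_sq p q)"
proof -
  let ?D = "(sqrt C + 1)\<^sup>2"
  let ?f = "\<lambda>x. ?D * (sqrt (pmf p x) - sqrt (pmf q x))\<^sup>2 + 2 * pmf p x - pmf q x"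
  have bound: "pmf q x * (pmf p x / pmf q x)\<^sup>2 \<le> ?f x" for x
  proof (cases "pmf q x = 0")
    case True
    then have "pmf p x = 0"
      using le[of x] pmf_nonneg[of p x] by simp
    then show ?thesis using True by simp
  next
    case False
    define a b where "a = sqrt (pmf p x)" and "b = sqrt (pmf q x)"
    have ab: "0 \<le> a" "0 < b" "pmf p x = a\<^sup>2" "pmf q x = b\<^sup>2"
      using False pmf_pos[OF False] by (auto simp: a_def b_def)
    have "a \<le> sqrt C * b"
      using real_sqrt_le_mono[OF le[of x]] by (simp add: a_def b_def real_sqrt_mult)
    then have "(a + b)\<^sup>2 \<le> (sqrt C * b + b)\<^sup>2"
      using ab by (intro power_mono) auto
    also have "\<dots> = ?D * b\<^sup>2"
      by (simp add: power2_eq_square algebra_simps)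
    finally have "(a - b)\<^sup>2 * (a + b)\<^sup>2 \<le> (a - b)\<^sup>2 * (?D * b\<^sup>2)"
      by (intro mult_left_mono) auto
    then have "a\<^sup>2 * a\<^sup>2 \<le> (?D * (a - b)\<^sup>2 + 2 * a\<^sup>2 - b\<^sup>2) * b\<^sup>2"
      by (simp add: power2_eq_square algebra_simps)
    then show ?thesis
      using ab(1,2) unfolding ab(3,4) by (simp add: pos_divide_le_eq power_divide power2_eq_square)
  qed
  have "has_bochner_integral (count_space UNIV) ?f (?D * (2 * hellinger_sq p q) + 2 * 1 - 1)"
    unfolding hellinger_sq_eq_integral
    by (intro has_bochner_integral_diff has_bochner_integral_mult_right has_bochner_integral_add)
      (simp_all add: has_bochner_integral_iff integrable_sqrt_pmf_diff integrable_pmf integral_pmf_UNIV)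
  \<comment> \<open>Not evident from the form of \<open>?f\<close>, which contains a negative term;
    it follows because \<open>?f\<close> dominates a nonnegative function.\<close>
  moreover have "0 \<le> ?f x" for x
    using bound[of x] by (rule order_trans[rotated]) simp
  ultimately have f: "(\<integral>\<^sup>+x. ennreal (?f x) \<partial>count_space UNIV) = ennreal (1 + 2 * ?D * hellinger_sq p q)"
    by (subst nn_integral_eq_integral) (auto simp: has_bochner_integral_iff mult_ac)
  have "(\<integral>\<^sup>+x. ennreal ((pmf p x / pmf q x)\<^sup>2) \<partial>q) =
      (\<integral>\<^sup>+x. ennreal (pmf q x * (pmf p x / pmf q x)\<^sup>2) \<partial>count_space UNIV)"
    by (simp add: nn_integral_measure_pmf flip: ennreal_mult)
  also have "\<dots> \<le> (\<integral>\<^sup>+x. ennreal (?f x) \<partial>count_space UNIV)"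
    by (intro nn_integral_mono ennreal_leI bound)
  finally show ?thesis by (simp add: f)
qed

text \<open>Write the \<open>p\<close>-probability of \<open>A\<close> as the \<open>q\<close>-mean
  of the indicator times the likelihood ratio \<open>?g\<close> and apply Cauchy-Schwarz; by
  independence the second moment of \<open>?g\<close> is an \<open>n\<close>-th power.\<close>

lemma prob_replicate_pmf_sq_le:
  fixes p q :: "'a pmf"
  assumes ac: "\<And>x. pmf q x = 0 \<Longrightarrow> pmf p x = 0"
    and chi: "(\<integral>\<^sup>+x. ennreal ((pmf p x / pmf q x)\<^sup>2) \<partial>q) \<le> ennreal c" and "0 \<le> c"
  shows "(measure_pmf.prob (replicate_pmf n p) A)\<^sup>2 \<le> measure_pmf.prob (replicate_pmf n q) A * c ^ n"
proof -
  let ?P = "replicate_pmf n p" and ?Q = "replicate_pmf n q"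
  let ?g = "\<lambda>xs. prod_list (map (\<lambda>x. pmf p x / pmf q x) xs)"
  have g0: "0 \<le> ?g xs" for xs
    by (induction xs) auto
  have g2: "(?g xs)\<^sup>2 = prod_list (map (\<lambda>x. (pmf p x / pmf q x)\<^sup>2) xs)" for xs
    by (induction xs) (simp_all add: power_mult_distrib power_divide)
  have "prod_list (map (pmf q) xs) * ?g xs = prod_list (map (pmf p) xs)" for xs
  proof (induction xs)
    case (Cons x xs)
    have "pmf q x * (pmf p x / pmf q x) = pmf p x"
      using ac[of x] by (cases "pmf q x = 0") auto
    then show ?case
      using Cons.IH by (simp add: mult_ac) (metis mult.assoc mult.commute times_divide_eq_right)
  qed simp
  then have Q: "pmf ?Q xs * ?g xs = pmf ?P xs" for xs
    by (simp add: pmf_replicate_pmf)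
  have "(\<integral>\<^sup>+xs. indicator A xs * ennreal (?g xs) \<partial>?Q) = (\<integral>\<^sup>+xs. ennreal (pmf ?P xs) * indicator A xs \<partial>count_space UNIV)"
    by (simp add: nn_integral_measure_pmf Q[symmetric] ennreal_mult g0 mult_ac)
  also have "\<dots> = emeasure ?P A"
    by (simp flip: nn_integral_measure_pmf)
  finally have "(emeasure ?P A)\<^sup>2 = (\<integral>\<^sup>+xs. indicator A xs * ennreal (?g xs) \<partial>?Q)\<^sup>2"
    by simp
  also have "\<dots> \<le> (\<integral>\<^sup>+xs. (indicator A xs)\<^sup>2 \<partial>?Q) * (\<integral>\<^sup>+xs. (ennreal (?g xs))\<^sup>2 \<partial>?Q)"
    by (rule Cauchy_Schwarz_nn_integral) auto
  also have "(\<integral>\<^sup>+xs. (indicator A xs)\<^sup>2 \<partial>?Q) = emeasure ?Q A"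
    by (subst nn_integral_indicator[symmetric], simp, intro nn_integral_cong) (auto simp: indicator_def)
  also have "(\<integral>\<^sup>+xs. (ennreal (?g xs))\<^sup>2 \<partial>?Q) = (\<integral>\<^sup>+x. ennreal ((pmf p x / pmf q x)\<^sup>2) \<partial>q) ^ n"
    by (simp add: ennreal_power g0 g2 nn_integral_prod_list_replicate_pmf)
  also have "\<dots> \<le> ennreal c ^ n"
    by (intro power_mono chi) simp
  finally have "(emeasure ?P A)\<^sup>2 \<le> emeasure ?Q A * ennreal c ^ n"
    by (simp add: mult_left_mono)
  then show ?thesis
    using \<open>0 \<le> c\<close> by (simp add: measure_pmf.emeasure_eq_measure ennreal_power flip: ennreal_mult)
qed

section \<open>Lower bound: events decided by a stopped test\<close>

context
  fixes T :: "(nat \<Rightarrow> 'a::countable) \<Rightarrow> enat" and \<phi> :: "'a list \<Rightarrow> hypothesis"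
  assumes T: "sequential_stopping_time T"
begin

lemma stopping_time_cong:
  assumes "\<And>i. i < n \<Longrightarrow> \<omega> i = \<omega>' i" "t \<le> n"
  shows "T \<omega> = enat t \<longleftrightarrow> T \<omega>' = enat t"
  using T assms by (simp add: sequential_stopping_time_def)

lemma early_output_cong:
  assumes "\<And>i. i < n \<Longrightarrow> \<omega> i = \<omega>' i" "T \<omega> \<le> enat n"
  shows "T \<omega>' = T \<omega>" "test_output T \<phi> \<omega>' = test_output T \<phi> \<omega>"
proof -
  obtain t where t: "T \<omega> = enat t" "t \<le> n"
    using assms(2) by (cases "T \<omega>") auto
  then show *: "T \<omega>' = T \<omega>"
    using stopping_time_cong[of n \<omega> \<omega>' t] assms(1) by simp
  have prefix: "map \<omega>' [0..<t] = map \<omega> [0..<t]"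
    using assms(1) t(2) by simp
  then show "test_output T \<phi> \<omega>' = test_output T \<phi> \<omega>"
    unfolding test_output_def * t(1) by (simp only: enat.case prefix)
qed

text \<open>The conjunct \<open>T \<omega> \<le> enat n\<close> makes this an event of the first
  \<open>n\<close> samples, which a condition on the output alone need not be.\<close>

lemma early_output_iff:
  assumes "\<And>i. i < n \<Longrightarrow> \<omega> i = \<omega>' i"
  shows "T \<omega> \<le> enat n \<and> R (test_output T \<phi> \<omega>) \<longleftrightarrow> T \<omega>' \<le> enat n \<and> R (test_output T \<phi> \<omega>')"
  using early_output_cong[of n \<omega> \<omega>'] early_output_cong[of n \<omega>' \<omega>] assms by metis

lemma sets_early_output:
  "{\<omega>. T \<omega> \<le> enat n \<and> R (test_output T \<phi> \<omega>)} \<in> sets (iid_samples p)"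
  by (rule prefix_event_measurable[of n]) (rule early_output_iff)

text \<open>An answer is given only at a finite time, so the event is a countable union of prefix
  events.\<close>

lemma sets_output: "{\<omega>. test_output T \<phi> \<omega> = Some H} \<in> sets (iid_samples p)"
proof -
  have "\<exists>n. T \<omega> \<le> enat n" if "test_output T \<phi> \<omega> = Some H" for \<omega>
    using that by (auto simp: test_output_def split: enat.splits)
  then have "{\<omega>. test_output T \<phi> \<omega> = Some H} =
      (\<Union>n. {\<omega>. T \<omega> \<le> enat n \<and> test_output T \<phi> \<omega> = Some H})"
    by auto
  also have "\<dots> \<in> sets (iid_samples p)"
    by (auto intro!: sets.countable_UN sets_early_output[where R = "\<lambda>z. z = Some H"])
  finally show ?thesis .
qed

lemma measurable_stopping_time: "T \<in> iid_samples p \<rightarrow>\<^sub>M count_space UNIV"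
proof -
  have fin: "T -` {enat t} \<in> sets (iid_samples p)" for t
    unfolding vimage_def singleton_iff
    by (rule prefix_event_measurable[of t]) (rule stopping_time_cong[OF _ order_refl], blast)
  have "T \<omega> = \<infinity> \<longleftrightarrow> (\<forall>t. T \<omega> \<noteq> enat t)" for \<omega>
    by (cases "T \<omega>") auto
  then have "T -` {\<infinity>} = space (iid_samples p) - (\<Union>t. T -` {enat t})"
    by auto
  also have "\<dots> \<in> sets (iid_samples p)"
    using fin by (intro sets.Diff sets.top sets.countable_UN) auto
  finally have "T -` {\<infinity>} \<in> sets (iid_samples p)" .
  then have "T -` {k} \<in> sets (iid_samples p)" for k
    using fin by (cases k) auto
  then show ?thesis
    unfolding measurable_count_space_eq_countable[OF countableI_type] by simp
qed

lemma prob_late_le: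
  assumes "expected_time p T \<le> ennreal n" "0 \<le> n"
  shows "measure (iid_samples p) {\<omega>. enat N < T \<omega>} \<le> n / (real N + 1)"
proof -
  interpret prob_space "iid_samples p" by (rule prob_space_iid_samples)
  have m: "{\<omega>. enat N < T \<omega>} \<in> sets (iid_samples p)"
    using measurable_sets[OF measurable_stopping_time, of "{enat N<..}"] by (simp add: vimage_def)
  \<comment> \<open>Integrality gains the 1 in Markov's inequality, which later compensates for the
    floor in the choice of \<open>N\<close>.\<close>
  have "ennreal (real N + 1) \<le> ennreal_of_enat (T \<omega>)" if "enat N < T \<omega>" for \<omega>
  proof (cases "T \<omega>")
    case (enat t)
    then have "real N + 1 \<le> real t"
      using that by simp
    then show ?thesis
      unfolding enat ennreal_of_enat_enat ennreal_of_nat_eq_real_of_nat by (rule ennreal_leI)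
  qed simp
  then have "(\<integral>\<^sup>+\<omega>. ennreal (real N + 1) * indicator {\<omega>. enat N < T \<omega>} \<omega> \<partial>iid_samples p) \<le> expected_time p T"
    unfolding expected_time_def by (intro nn_integral_mono) (auto simp: indicator_def)
  also note assms(1)
  finally have "ennreal (real N + 1) * emeasure (iid_samples p) {\<omega>. enat N < T \<omega>} \<le> ennreal n"
    using m by (simp add: nn_integral_cmult_indicator)
  then have "ennreal ((real N + 1) * prob {\<omega>. enat N < T \<omega>}) \<le> ennreal n"
    unfolding emeasure_eq_measure by (subst ennreal_mult) auto
  then have "(real N + 1) * prob {\<omega>. enat N < T \<omega>} \<le> n"
    using assms(2) by simp
  then show ?thesis by (simp add: field_simps)
qed

text \<open>Kept free of the labels' roles, with time bounded only under \<open>p\<close>, so that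
  it also applies with the two hypotheses exchanged.\<close>

lemma expected_time_lower_bound:
  fixes p q :: "'a pmf"
  assumes "C > 1" and le: "\<And>x. pmf p x \<le> C * pmf q x" and "H \<noteq> H'"
    and "error_prob p H T \<phi> \<le> 1/4" and q: "error_prob q H' T \<phi> \<le> b"
    and b: "0 < b" "b < 1/4" and n: "expected_time p T \<le> ennreal n" "0 \<le> n"
  shows "ln (1 / b) \<le> 100 * (sqrt C + 1)\<^sup>2 * hellinger_sq p q * n"
proof -
  interpret P: prob_space "iid_samples p" by (rule prob_space_iid_samples)
  interpret Q: prob_space "iid_samples q" by (rule prob_space_iid_samples)
  let ?D = "(sqrt C + 1)\<^sup>2" and ?h = "hellinger_sq p q"
  \<comment> \<open>The factor 25 leaves \<open>1 - 1/4 - 1/25 = 71/100\<close> for the probability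
    of \<open>?A\<close>, whose square still exceeds 1/2.\<close>
  define N where "N = nat \<lfloor>25 * n\<rfloor>"
  have N: "real N \<le> 25 * n" "25 * n < real N + 1"
    using n(2) unfolding N_def by linarith+
  let ?A = "{\<omega>. T \<omega> \<le> enat N \<and> test_output T \<phi> \<omega> = Some H}"
  have A: "?A \<in> sets (iid_samples r)" for r
    by (rule sets_early_output[where R = "\<lambda>z. z = Some H"])
  have wrong: "{\<omega>. test_output T \<phi> \<omega> \<noteq> Some G} \<in> sets (iid_samples r)" for G r
  proof -
    have "{\<omega>. test_output T \<phi> \<omega> \<noteq> Some G} =
        space (iid_samples r) - {\<omega>. test_output T \<phi> \<omega> = Some G}"
      by auto
    then show ?thesis
      by (simp only: sets.compl_sets sets_output)
  qed
  have late: "{\<omega>. enat N < T \<omega>} \<in> sets (iid_samples p)"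
    using measurable_sets[OF measurable_stopping_time, of "{enat N<..}"] by (simp add: vimage_def)
  \<comment> \<open>Paths that never stop lie in both of the last two sets.\<close>
  have "UNIV = ?A \<union> ({\<omega>. test_output T \<phi> \<omega> \<noteq> Some H} \<union> {\<omega>. enat N < T \<omega>})"
    by auto
  then have "1 = P.prob (?A \<union> ({\<omega>. test_output T \<phi> \<omega> \<noteq> Some H} \<union> {\<omega>. enat N < T \<omega>}))"
    using P.prob_space by simp
  also have "\<dots> \<le> P.prob ?A + (P.prob {\<omega>. test_output T \<phi> \<omega> \<noteq> Some H} + P.prob {\<omega>. enat N < T \<omega>})"
    using A[of p] wrong[of H p] late
    by (intro order_trans[OF measure_Un_le] add_left_mono order_trans[OF measure_Un_le] order_refl) auto
  finally have "1 \<le> P.prob ?A + 1/4 + P.prob {\<omega>. enat N < T \<omega>}"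
    using assms(4) by (simp add: error_prob_def)
  moreover have "P.prob {\<omega>. enat N < T \<omega>} \<le> 1/25"
  proof -
    have "n / (real N + 1) \<le> 1/25"
      using N(2) by (simp add: field_simps)
    then show ?thesis
      using prob_late_le[OF n, of N] by linarith
  qed
  ultimately have "71/100 \<le> P.prob ?A"
    by linarith
  then have "(71/100)\<^sup>2 \<le> (P.prob ?A)\<^sup>2"
    by (intro power_mono) auto
  then have half: "1/2 \<le> (P.prob ?A)\<^sup>2"
    by (simp add: power2_eq_square)
  have "Q.prob ?A \<le> Q.prob {\<omega>. test_output T \<phi> \<omega> \<noteq> Some H'}"
    using \<open>H \<noteq> H'\<close> by (intro Q.finite_measure_mono wrong) auto
  then have QA: "Q.prob ?A \<le> b"
    using q by (simp add: error_prob_def)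
  have ac: "pmf p x = 0" if "pmf q x = 0" for x
    using le[of x] that pmf_nonneg[of p x] by simp
  have h: "0 \<le> 2 * ?D * ?h"
    by (simp add: hellinger_sq_nonneg)
  have prefix: "measure (iid_samples r) ?A =
      measure_pmf.prob (replicate_pmf N r)
        {xs. T (\<lambda>i. xs ! i) \<le> enat N \<and> test_output T \<phi> (\<lambda>i. xs ! i) = Some H}" for r
    by (rule measure_prefix_event) (rule early_output_iff[where R = "\<lambda>z. z = Some H"])
  have "(P.prob ?A)\<^sup>2 \<le> Q.prob ?A * (1 + 2 * ?D * ?h) ^ N"
    unfolding prefix using h
    by (intro prob_replicate_pmf_sq_le nn_integral_ratio_sq_le ac le assms) auto
  also have "\<dots> \<le> b * exp (2 * ?D * ?h) ^ N"
    using QA h exp_ge_add_one_self[of "2 * ?D * ?h"] b by (intro mult_mono power_mono) auto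
  also have "\<dots> = b * exp (real N * (2 * ?D * ?h))"
    by (simp only: exp_of_nat_mult)
  finally have "1 / b \<le> 2 * exp (real N * (2 * ?D * ?h))"
    using half b(1) by (simp add: field_simps)
  then have "ln (1 / b) \<le> ln (2 * exp (real N * (2 * ?D * ?h)))"
    using b(1) by (subst ln_le_cancel_iff) auto
  also have "\<dots> = ln 2 + real N * (2 * ?D * ?h)"
    by (simp add: ln_mult)
  finally have "ln (1 / b) \<le> ln 2 + real N * (2 * ?D * ?h)" .
  \<comment> \<open>Since \<open>b < 1/4\<close>, the term \<open>ln 2\<close> is at most half of
    the left-hand side; absorbing it doubles \<open>25 * 2 = 50\<close> to the constant 100.\<close>
  moreover have "2 * ln 2 \<le> ln (1 / b)"
  proof -
    have "2 * ln 2 = ln (4::real)"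
      using ln_realpow[of 2 2] by simp
    also have "\<dots> \<le> ln (1 / b)"
      using b by (subst ln_le_cancel_iff) (auto simp: field_simps)
    finally show ?thesis .
  qed
  moreover have "real N * (2 * ?D * ?h) \<le> 25 * n * (2 * ?D * ?h)"
    using N(1) h by (intro mult_right_mono)
  ultimately show ?thesis by (simp add: algebra_simps)
qed

end

section \<open>Lower bound for the infimum and the two-sided estimate\<close>

lemma n_SEQ_lower:
  fixes p q :: "'a::countable pmf"
  assumes "C > 1" "set_pmf p \<subseteq> X" "set_pmf q \<subseteq> X" "bounded_likelihood_ratio C X p q"
    and \<alpha>: "\<alpha> \<in> {0<..<1/4}" and \<beta>: "\<beta> \<in> {0<..<1/4}"
  shows "ennreal (1 / (100 * (sqrt C + 1)\<^sup>2)) *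
      (ennreal (ln (1 / min \<alpha> \<beta>)) / ennreal (hellinger_sq p q)) \<le> n_SEQ p q \<alpha> \<beta>"
  unfolding n_SEQ_def
proof (intro INF_greatest, elim CollectE conjE exE)
  fix n :: real and T and \<phi> :: "'a list \<Rightarrow> hypothesis"
  assume n: "0 \<le> n" and T: "sequential_stopping_time T"
    and err: "error_prob p Hyp_p T \<phi> \<le> \<alpha>" "error_prob q Hyp_q T \<phi> \<le> \<beta>"
    and "max (expected_time p T) (expected_time q T) \<le> ennreal n"
  then have time: "expected_time p T \<le> ennreal n" "expected_time q T \<le> ennreal n"
    by auto
  let ?K = "100 * (sqrt C + 1)\<^sup>2" and ?h = "hellinger_sq p q" and ?L = "ln (1 / min \<alpha> \<beta>)"
  have pq: "pmf p x \<le> C * pmf q x" and qp: "pmf q x \<le> C * pmf p x" for x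
    using bounded_likelihood_ratio_le[OF assms(1-4)] bounded_likelihood_ratio_ge[OF assms(1-4)] by auto
  have L: "?L \<le> ?K * ?h * n"
  \<comment> \<open>The smaller error level takes the role of \<open>b\<close>; for the other one
    only the bound 1/4 matters.\<close>
  proof (cases "\<beta> \<le> \<alpha>")
    case True
    then show ?thesis
      using expected_time_lower_bound[OF T assms(1) pq, of Hyp_p Hyp_q \<phi> \<beta> n] err time n \<alpha> \<beta>
      by (simp add: min_def)
  next
    case False
    then show ?thesis
      using expected_time_lower_bound[OF T assms(1) qp, of Hyp_q Hyp_p \<phi> \<alpha> n] err time n \<alpha> \<beta>
      by (simp add: min_def hellinger_sq_sym[of q p])
  qed
  have "0 < ?L"
    using \<alpha> \<beta> by (intro ln_gt_zero) (auto simp: min_def)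
  \<comment> \<open>An admissible \<open>n\<close> excludes distance zero, so the extended quotient
    is an ordinary real one.\<close>
  then have "?h \<noteq> 0"
    using L by auto
  then have h: "0 < ?h"
    using hellinger_sq_nonneg[of p q] by simp
  have K: "0 < ?K"
    using assms(1) by (intro mult_pos_pos zero_less_power add_pos_pos) auto
  have "ennreal (1 / ?K) * (ennreal ?L / ennreal ?h) = ennreal (1 / ?K * (?L / ?h))"
    using h \<open>0 < ?L\<close> K by (simp only: divide_ennreal ennreal_mult less_imp_le zero_le_divide_1_iff divide_nonneg_pos)
  also have "\<dots> \<le> ennreal n"
    using L h K by (intro ennreal_leI) (simp add: pos_divide_le_eq mult_ac)
  finally show "ennreal (1 / ?K) * (ennreal ?L / ennreal ?h) \<le> ennreal n" .
qed

theorem theorem10p5: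
  fixes C :: real
  assumes "C > 1"
  shows "\<exists>c\<^sub>1 c\<^sub>2 :: real. c\<^sub>1 > 0 \<and> c\<^sub>2 > 0 \<and>
    (\<forall>(X :: 'a::countable set) (p :: 'a pmf) (q :: 'a pmf) (\<alpha> :: real) (\<beta> :: real).
       set_pmf p \<subseteq> X \<longrightarrow> set_pmf q \<subseteq> X \<longrightarrow> bounded_likelihood_ratio C X p q \<longrightarrow>
       \<alpha> \<in> {0<..<1/4} \<longrightarrow> \<beta> \<in> {0<..<1/4} \<longrightarrow>
       ennreal c\<^sub>1 * (ennreal (ln (1 / min \<alpha> \<beta>)) / ennreal (hellinger_sq p q)) \<le> n_SEQ p q \<alpha> \<beta> \<and>
       n_SEQ p q \<alpha> \<beta> \<le> ennreal c\<^sub>2 * (ennreal (ln (1 / min \<alpha> \<beta>)) / ennreal (hellinger_sq p q)))"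
proof (intro exI conjI allI impI)
  show "0 < 1 / (100 * (sqrt C + 1)\<^sup>2)"
    using assms by (intro divide_pos_pos mult_pos_pos zero_less_power add_pos_pos) auto
  show "(0::real) < 2" by simp
next
  fix X and p q :: "'a pmf" and \<alpha> \<beta> :: real
  assume a: "set_pmf p \<subseteq> X" "set_pmf q \<subseteq> X" "bounded_likelihood_ratio C X p q"
    "\<alpha> \<in> {0<..<1/4}" "\<beta> \<in> {0<..<1/4}"
  show "ennreal (1 / (100 * (sqrt C + 1)\<^sup>2)) *
      (ennreal (ln (1 / min \<alpha> \<beta>)) / ennreal (hellinger_sq p q)) \<le> n_SEQ p q \<alpha> \<beta>"
    by (rule n_SEQ_lower[OF assms a])
  show "n_SEQ p q \<alpha> \<beta> \<le> ennreal 2 * (ennreal (ln (1 / min \<alpha> \<beta>)) / ennreal (hellinger_sq p q))"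
    using n_SEQ_upper[OF a(4,5), of p q] by simp
qed

end
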